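(* Let $\lambda>0$ and $r>0$ be fixed. Let $X_1,\dots,X_n$ be i.i.d. exponential random variables with mean $\lambda^{-1}$, with order statistics $X_{(1)}\le\dots\le X_{(n)}$, and let $Y_i=X_{(i+1)}-X_{(i)}$ for $1\le i\le n-1$. Let $$H(n,r)=\sum_{i=1}^{n-1}\max\{Y_i-r,0\},\qquad NH(n,r)=\sum_{i=1}^{n-1}\mathbf{1}_{\{Y_i>r\}}$$ be the total length of the holes and the number of holes. Then, as $n\to\infty$, each of $H(n,r)$ and $NH(n,r)$ converges in distribution to a random variable with finite mean and variance.
   Context: All notation is introduced in the claim; $\mathbf{1}_A$ denotes the indicator of the event $A$. *)

theory Defs
  imports "HOL-Probability.Probability"
begin

(* 1-based: order_stat n x k is the k-th smallest of x 1, ..., x n, counted with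
   multiplicity; meaningful only for 1 \<le> k \<le> n. *)
definition order_stat :: "nat \<Rightarrow> (nat \<Rightarrow> real) \<Rightarrow> nat \<Rightarrow> real" where
  "order_stat n x k = sort (map x [1..<Suc n]) ! (k - 1)"

definition gap :: "nat \<Rightarrow> (nat \<Rightarrow> real) \<Rightarrow> nat \<Rightarrow> real" where
  "gap n x i = order_stat n x (i + 1) - order_stat n x i"

definition hole_length :: "nat \<Rightarrow> real \<Rightarrow> (nat \<Rightarrow> real) \<Rightarrow> real" where
  "hole_length n r x = (\<Sum>i = 1..n - 1. max (gap n x i - r) 0)"

(* real-valued so that its law is a measure on the real line, as weak_conv_m requires *)
definition num_holes :: "nat \<Rightarrow> real \<Rightarrow> (nat \<Rightarrow> real) \<Rightarrow> real" where
  "num_holes n r x = (\<Sum>i = 1..n - 1. of_bool (gap n x i > r))"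

(* Convergence in distribution of real random variables W n, each on its own
   probability space M n, to Z on N: weak convergence of the laws. *)
definition converges_in_distribution ::
    "(nat \<Rightarrow> 'a measure) \<Rightarrow> (nat \<Rightarrow> 'a \<Rightarrow> real) \<Rightarrow> 'b measure \<Rightarrow> ('b \<Rightarrow> real) \<Rightarrow> bool" where
  "converges_in_distribution M W N Z \<longleftrightarrow>
     weak_conv_m (\<lambda>n. distr (M n) borel (W n)) (distr N borel Z)"

(* Integrability is stated explicitly, since the library's expectation and variance
   default to 0 for non-integrable functions. *)
definition finite_mean_variance :: "'b measure \<Rightarrow> ('b \<Rightarrow> real) \<Rightarrow> bool" where
  "finite_mean_variance N Z \<longleftrightarrow>
     integrable N Z \<and> integrable N (\<lambda>\<omega>. (Z \<omega> - integral\<^sup>L N Z)\<^sup>2)"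

end

theory Submission
  imports Defs
begin

text \<open>
Reading the order statistics from right to left, the memoryless property makes the spacings of
\<open>n\<close> exponential variables of rate \<open>l\<close> independent, and the spacing that has \<open>j + 1\<close> observations to
its right is exponential of rate \<open>(j + 1) l\<close> (Renyi).  These rates do not involve \<open>n\<close>.  A statistic
that sums a function \<open>f\<close> over all spacings therefore has the same law as a partial sum, with
\<open>n - 1\<close> terms, of one fixed series \<open>\<Sum>j. f (E\<^sub>j)\<close> with independent \<open>E\<^sub>j\<close> of rate \<open>(j + 1) l\<close>.

If \<open>0 \<le> f y \<le> C y\<^sup>2\<close>, the mean square of \<open>f (E\<^sub>j)\<close> is at most of order \<open>1 / (j + 1)\<^sup>4\<close>, so the
series converges almost surely to a square integrable variable, and the partial sums converge to
it in distribution.  The total length and the number of the holes are the cases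
\<open>f y = max (y - r) 0\<close> and \<open>f y =\<close> indicator of \<open>y > r\<close>; both satisfy the quadratic bound because
they vanish for \<open>y \<le> r\<close> and grow at most linearly.

The representation of the spacings is \<open>joint_law_of_min_and_spacing_sum\<close>, the convergence of the
series is \<open>partial_sum_law_converges\<close>, and \<open>spacing_sum_converges_in_distribution\<close> combines them.
\<close>

section \<open>Sums over the spacings of a finite sample\<close>

text \<open>
A finite index set rather than an initial segment of the naturals carries the sample, so that
an arbitrary observation can be removed without renumbering the others.
\<close>
definition sorted_values :: "'i set \<Rightarrow> ('i \<Rightarrow> 'a::linorder) \<Rightarrow> 'a list" where
  "sorted_values J x = sorted_list_of_multiset (image_mset x (mset_set J))"

definition spacing_sum :: "(real \<Rightarrow> 'b::comm_monoid_add) \<Rightarrow> real list \<Rightarrow> 'b" where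
  "spacing_sum f xs = (\<Sum>i<length xs - 1. f (xs ! Suc i - xs ! i))"

lemma spacing_sum_single [simp]: "spacing_sum f [x] = 0"
  by (simp add: spacing_sum_def)

lemma spacing_sum_Nil [simp]: "spacing_sum f [] = 0"
  by (simp add: spacing_sum_def)

lemma spacing_sum_Cons:
  assumes "xs \<noteq> []"
  shows "spacing_sum f (x # xs) = f (hd xs - x) + spacing_sum f xs"
proof -
  obtain y ys where "xs = y # ys" using assms by (cases xs) auto
  then show ?thesis
    by (simp add: spacing_sum_def sum.lessThan_Suc_shift del: sum.lessThan_Suc)
qed

lemma sorted_values_eq_sort:
  "distinct is \<Longrightarrow> sorted_values (set is) x = sort (map x is)"
  unfolding sorted_values_def
  by (subst mset_set_set, assumption, subst mset_map [symmetric], rule sorted_list_of_multiset_mset)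

lemma sorted_values_Nil_iff [simp]: "finite J \<Longrightarrow> sorted_values J x = [] \<longleftrightarrow> J = {}"
  unfolding sorted_values_def
  by (metis image_mset_is_empty_iff mset_set_empty_iff mset_sorted_list_of_multiset
      mset_zero_iff sorted_list_of_multiset_empty)

lemma set_sorted_values [simp]: "finite J \<Longrightarrow> set (sorted_values J x) = x ` J"
  by (simp add: sorted_values_def)

lemma sorted_values_cong:
  "(\<And>j. j \<in> J \<Longrightarrow> x j = y j) \<Longrightarrow> sorted_values J x = sorted_values J y"
  unfolding sorted_values_def
  by (cases "finite J") (auto intro!: arg_cong[where f=sorted_list_of_multiset] image_mset_cong)

lemma hd_sorted_values_ge_iff:
  assumes "finite J" "J \<noteq> {}"
  shows "m \<le> hd (sorted_values J x) \<longleftrightarrow> (\<forall>j\<in>J. m \<le> x j)"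
proof -
  obtain y ys where s: "sorted_values J x = y # ys"
    using assms by (cases "sorted_values J x") auto
  have "sorted (y # ys)" "set (y # ys) = x ` J"
    using assms s[symmetric] by (simp_all add: sorted_values_def)
  then show ?thesis using s
    by (metis (no_types, lifting) dual_order.trans imageE image_eqI list.sel(1) list.set_intros(1)
         set_ConsD sorted_simps(2))
qed

text \<open>
Ties do no harm: any index that attains the minimum may serve as the first one.
\<close>
lemma sorted_values_least:
  assumes "finite J" "i \<in> J" "\<And>j. j \<in> J \<Longrightarrow> x i \<le> x j"
  shows "sorted_values J x = x i # sorted_values (J - {i}) x"
proof -
  have "image_mset x (mset_set J) = add_mset (x i) (image_mset x (mset_set (J - {i})))"
    using assms(1,2) by (simp add: mset_set.remove)
  then show ?thesis using assms
    unfolding sorted_values_def by (simp add: insort_is_Cons)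
qed

section \<open>Measurability of order statistics\<close>

text \<open>
Replacing \<open>(g, k)\<close> by the pair \<open>(min g k, max g k)\<close> and inserting the maximum further right
turns the case distinctions of insertion sort into measurable operations.  Hence every entry of
the sorted sample is a measurable function of the sample.
\<close>
lemma measurable_insort:
  fixes g :: "'a \<Rightarrow> real"
  assumes "g \<in> borel_measurable M" "set gs \<subseteq> borel_measurable M"
  shows "\<exists>hs. set hs \<subseteq> borel_measurable M \<and> length hs = Suc (length gs) \<and>
           (\<forall>\<omega>. sorted (map (\<lambda>h. h \<omega>) gs) \<longrightarrow> insort (g \<omega>) (map (\<lambda>h. h \<omega>) gs) = map (\<lambda>h. h \<omega>) hs)"
  using assms
proof (induction gs arbitrary: g)
  case Nil
  then show ?case by (intro exI[of _ "[g]"]) auto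
next
  case (Cons k gs)
  have "(\<lambda>\<omega>. max (g \<omega>) (k \<omega>)) \<in> borel_measurable M" using Cons.prems by (intro borel_measurable_max) auto
  from Cons.IH[OF this] Cons.prems obtain hs where hs: "set hs \<subseteq> borel_measurable M" "length hs = Suc (length gs)"
    "\<And>\<omega>. sorted (map (\<lambda>h. h \<omega>) gs) \<Longrightarrow>
       insort (max (g \<omega>) (k \<omega>)) (map (\<lambda>h. h \<omega>) gs) = map (\<lambda>h. h \<omega>) hs"
    by auto
  have "insort (g \<omega>) (map (\<lambda>h. h \<omega>) (k # gs)) = map (\<lambda>h. h \<omega>) ((\<lambda>\<omega>. min (g \<omega>) (k \<omega>)) # hs)"
    if "sorted (map (\<lambda>h. h \<omega>) (k # gs))" for \<omega>
    using hs(3)[of \<omega>] that by (auto simp: min_def max_def insort_is_Cons)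
  moreover have "set ((\<lambda>\<omega>. min (g \<omega>) (k \<omega>)) # hs) \<subseteq> borel_measurable M"
    using hs(1) Cons.prems by auto
  ultimately show ?case using hs(2)
    by (intro exI[of _ "(\<lambda>\<omega>. min (g \<omega>) (k \<omega>)) # hs"]) auto
qed

lemma measurable_sort:
  fixes fs :: "('a \<Rightarrow> real) list"
  assumes "set fs \<subseteq> borel_measurable M"
  obtains gs where "set gs \<subseteq> borel_measurable M" "length gs = length fs"
    "\<And>\<omega>. sort (map (\<lambda>f. f \<omega>) fs) = map (\<lambda>g. g \<omega>) gs"
proof -
  have "\<exists>gs. set gs \<subseteq> borel_measurable M \<and> length gs = length fs \<and>
    (\<forall>\<omega>. sort (map (\<lambda>f. f \<omega>) fs) = map (\<lambda>g. g \<omega>) gs)"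
    using assms
  proof (induction fs)
    case Nil
    then show ?case by simp
  next
    case (Cons f fs)
    then obtain gs where gs: "set gs \<subseteq> borel_measurable M" "length gs = length fs"
      "\<And>\<omega>. sort (map (\<lambda>f. f \<omega>) fs) = map (\<lambda>g. g \<omega>) gs" by auto
    have "f \<in> borel_measurable M" using Cons.prems by simp
    from measurable_insort[OF this gs(1)] obtain hs where "set hs \<subseteq> borel_measurable M"
      "length hs = Suc (length gs)" and hs: "\<And>\<omega>. sorted (map (\<lambda>h. h \<omega>) gs) \<Longrightarrow> insort (f \<omega>) (map (\<lambda>h. h \<omega>) gs) = map (\<lambda>h. h \<omega>) hs"
      by blast
    moreover have "sort (map (\<lambda>h. h \<omega>) (f # fs)) = map (\<lambda>h. h \<omega>) hs" for \<omega>
    proof -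
      have "sorted (map (\<lambda>h. h \<omega>) gs)" unfolding gs(3)[symmetric] by simp
      from hs[OF this] show ?thesis by (simp add: gs(3)[of \<omega>])
    qed
    ultimately show ?case using gs(2) by (intro exI[of _ hs]) auto
  qed
  then show thesis using that by blast
qed

lemma measurable_min_and_spacing_sum:
  fixes f :: "real \<Rightarrow> real"
  assumes "finite J" and f: "f \<in> borel_measurable borel"
    and "\<And>j. j \<in> J \<Longrightarrow> X j \<in> borel_measurable M"
  shows "J \<noteq> {} \<Longrightarrow> (\<lambda>\<omega>. hd (sorted_values J (\<lambda>j. X j \<omega>))) \<in> borel_measurable M"
    and "(\<lambda>\<omega>. spacing_sum f (sorted_values J (\<lambda>j. X j \<omega>))) \<in> borel_measurable M"
proof -
  obtain js where js: "distinct js" "set js = J"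
    using finite_distinct_list[OF assms(1)] by blast
  have "set (map X js) \<subseteq> borel_measurable M" using assms(3) js by auto
  then obtain gs where gs: "set gs \<subseteq> borel_measurable M" "length gs = length (map X js)"
    "\<And>\<omega>. sort (map (\<lambda>f. f \<omega>) (map X js)) = map (\<lambda>g. g \<omega>) gs"
    by (rule measurable_sort) blast
  have eq: "sorted_values J (\<lambda>j. X j \<omega>) = map (\<lambda>g. g \<omega>) gs" for \<omega>
    using sorted_values_eq_sort[OF js(1), of "\<lambda>j. X j \<omega>"] gs(3)[of \<omega>] js(2) by (simp add: comp_def)
  have nth: "gs ! i \<in> borel_measurable M" if "i < length gs" for i
    using gs(1) that by auto
  show "(\<lambda>\<omega>. hd (sorted_values J (\<lambda>j. X j \<omega>))) \<in> borel_measurable M" if "J \<noteq> {}"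
  proof -
    have "gs \<noteq> []" using that gs(2) js by auto
    then show ?thesis using nth[of 0] unfolding eq by (simp add: hd_map hd_conv_nth)
  qed
  have [measurable]: "f \<in> borel_measurable borel" by (rule f)
  have "(\<lambda>\<omega>. f ((gs ! Suc i) \<omega> - (gs ! i) \<omega>)) \<in> borel_measurable M" if "i < length gs - 1" for i
  proof -
    have [measurable]: "gs ! i \<in> borel_measurable M" "gs ! Suc i \<in> borel_measurable M"
      using that by (auto intro!: nth)
    show ?thesis by measurable
  qed
  then show "(\<lambda>\<omega>. spacing_sum f (sorted_values J (\<lambda>j. X j \<omega>))) \<in> borel_measurable M"
    unfolding eq spacing_sum_def by (auto intro!: borel_measurable_sum)
qed

section \<open>The memoryless property\<close>

definition exp_law :: "real \<Rightarrow> real measure" where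
  "exp_law a = density lborel (\<lambda>x. ennreal (exponential_density a x))"

lemma sets_exp_law [simp, measurable_cong]: "sets (exp_law a) = sets borel"
  by (simp add: exp_law_def)

lemma space_exp_law [simp]: "space (exp_law a) = UNIV"
  by (simp add: exp_law_def)

lemma prob_space_exp_law: "a > 0 \<Longrightarrow> prob_space (exp_law a)"
  unfolding exp_law_def by (rule prob_space_exponential_density)

lemma nn_integral_exp_law:
  "g \<in> borel_measurable borel \<Longrightarrow>
     (\<integral>\<^sup>+y. g y \<partial>exp_law a) = (\<integral>\<^sup>+y. ennreal (exponential_density a y) * g y \<partial>lborel)"
  unfolding exp_law_def by (subst nn_integral_density) auto

text \<open>
The memoryless property of two competing exponential clocks.  The clock of rate \<open>a\<close> rings first
with probability \<open>a / (a + b)\<close>; given that, its time \<open>m\<close> has rate \<open>a + b\<close>, and the delay \<open>z\<close>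
until the other clock rings is independent of \<open>m\<close> and still has rate \<open>b\<close>.  In terms of
densities, the factor \<open>exp (- b m)\<close> leaves the inner integral after the shift \<open>y = m + z\<close> and
turns the rate \<open>a\<close> of the outer density into \<open>a + b\<close>.
\<close>
lemma exponential_race:
  fixes K :: "real \<Rightarrow> real \<Rightarrow> ennreal"
  assumes "a > 0" "b > 0"
    and [measurable]: "(\<lambda>(m, z). K m z) \<in> borel_measurable (borel \<Otimes>\<^sub>M borel)"
  shows "(\<integral>\<^sup>+m. (\<integral>\<^sup>+y. (if m \<le> y then K m (y - m) else 0) \<partial>exp_law b) \<partial>exp_law a)
       = ennreal (a / (a + b)) * (\<integral>\<^sup>+m. (\<integral>\<^sup>+z. K m z \<partial>exp_law b) \<partial>exp_law (a + b))"
proof -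
  interpret b: prob_space "exp_law b" using assms by (intro prob_space_exp_law)
  define R where "R m = (\<integral>\<^sup>+z. K m z \<partial>exp_law b)" for m
  have [measurable]: "R \<in> borel_measurable borel"
    unfolding R_def by measurable
  have inner: "(\<integral>\<^sup>+y. (if m \<le> y then K m (y - m) else 0) \<partial>exp_law b) = ennreal (exp (- b * m)) * R m"
    if "m \<ge> 0" for m
  proof -
    have "(\<integral>\<^sup>+y. (if m \<le> y then K m (y - m) else 0) \<partial>exp_law b)
      = (\<integral>\<^sup>+z. ennreal (exponential_density b (m + 1 * z)) * (if m \<le> m + 1 * z then K m (m + 1 * z - m) else 0) \<partial>lborel)"
      by (subst nn_integral_exp_law, measurable, subst nn_integral_real_affine[where c=1 and t=m]) auto
    also have "\<dots> = (\<integral>\<^sup>+z. ennreal (exp (- b * m)) * (ennreal (exponential_density b z) * K m z) \<partial>lborel)"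
    proof (intro nn_integral_cong)
      fix z :: real
      show "ennreal (exponential_density b (m + 1 * z)) * (if m \<le> m + 1 * z then K m (m + 1 * z - m) else 0)
        = ennreal (exp (- b * m)) * (ennreal (exponential_density b z) * K m z)"
      proof (cases "z < 0")
        case False
        have "exponential_density b (m + z) = exp (- b * m) * exponential_density b z"
        proof -
          have "exp (- (m + z) * b) = exp (- b * m) * exp (- z * b)"
            by (subst exp_add[symmetric]) (simp add: algebra_simps)
          then show ?thesis using that False by (simp add: exponential_density_def)
        qed
        then show ?thesis using False by (simp add: ennreal_mult' mult.assoc)
      qed (simp add: exponential_density_def)
    qed
    also have "\<dots> = ennreal (exp (- b * m)) * R m"
      unfolding R_def by (subst nn_integral_exp_law, measurable, subst nn_integral_cmult) auto
    finally show ?thesis .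
  qed
  have "(\<integral>\<^sup>+m. (\<integral>\<^sup>+y. (if m \<le> y then K m (y - m) else 0) \<partial>exp_law b) \<partial>exp_law a)
     = (\<integral>\<^sup>+m. ennreal (exponential_density a m) * (\<integral>\<^sup>+y. (if m \<le> y then K m (y - m) else 0) \<partial>exp_law b) \<partial>lborel)"
    by (subst nn_integral_exp_law) auto
  also have "\<dots> = (\<integral>\<^sup>+m. ennreal (a / (a + b)) * (ennreal (exponential_density (a + b) m) * R m) \<partial>lborel)"
  proof (intro nn_integral_cong)
    fix m :: real
    show "ennreal (exponential_density a m) * (\<integral>\<^sup>+y. (if m \<le> y then K m (y - m) else 0) \<partial>exp_law b)
      = ennreal (a / (a + b)) * (ennreal (exponential_density (a + b) m) * R m)"
    proof (cases "m < 0")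
      case False
      moreover have "exp (- m * (a + b)) = exp (- m * a) * exp (- b * m)"
        by (subst exp_add[symmetric]) (simp add: algebra_simps)
      ultimately have "exponential_density a m * exp (- b * m) = a / (a + b) * exponential_density (a + b) m"
        using assms(1,2) by (simp only: exponential_density_def if_False) simp
      then have "ennreal (exponential_density a m) * ennreal (exp (- b * m))
          = ennreal (a / (a + b)) * ennreal (exponential_density (a + b) m)"
        using assms by (metis divide_nonneg_pos ennreal_mult' exponential_density_nonneg add_pos_pos less_imp_le)
      then show ?thesis using False inner[of m] by (simp add: mult.assoc[symmetric])
    qed (simp add: exponential_density_def)
  qed
  also have "\<dots> = ennreal (a / (a + b)) * (\<integral>\<^sup>+m. R m \<partial>exp_law (a + b))"
    by (subst nn_integral_cmult, measurable, subst nn_integral_exp_law) auto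
  finally show ?thesis unfolding R_def .
qed

text \<open>
Applying the inequality to the complement reverses it, because both masses are \<open>1\<close>.
\<close>
lemma prob_measures_eqI_le:
  assumes "prob_space M" "prob_space N" and sets: "sets M = sets N"
    and le: "\<And>A. A \<in> sets M \<Longrightarrow> emeasure M A \<le> emeasure N A"
  shows "M = N"
proof (rule measure_eqI[OF sets])
  interpret M: prob_space M by fact
  interpret N: prob_space N by fact
  fix A assume A: "A \<in> sets M"
  then have A': "A \<in> sets N" by (simp add: sets)
  have sp: "space M = space N" using sets by (rule sets_eq_imp_space_eq)
  have "measure M A \<le> measure N A"
    using le[OF A] by (simp add: M.emeasure_eq_measure N.emeasure_eq_measure)
  moreover have "measure M (space M - A) \<le> measure N (space N - A)"
    using le[OF sets.compl_sets[OF A]] by (simp add: M.emeasure_eq_measure N.emeasure_eq_measure sp)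
  ultimately show "emeasure M A = emeasure N A"
    using M.prob_compl[OF A] N.prob_compl[OF A']
    by (simp add: M.emeasure_eq_measure N.emeasure_eq_measure)
qed

section \<open>Independent spacings with increasing rates\<close>

text \<open>
Coordinate \<open>j\<close> models the spacing after which \<open>j + 1\<close> observations remain.  Counting the
spacings from the largest observation downwards makes the family the same for all sample sizes.
\<close>
definition independent_spacings :: "real \<Rightarrow> (nat \<Rightarrow> real) measure" where
  "independent_spacings l = (\<Pi>\<^sub>M j\<in>UNIV. exp_law (real (Suc j) * l))"

definition partial_sum_law :: "(real \<Rightarrow> real) \<Rightarrow> real \<Rightarrow> nat \<Rightarrow> real measure" where
  "partial_sum_law f l k = distr (independent_spacings l) borel (\<lambda>\<omega>. \<Sum>j<k. f (\<omega> j))"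

lemma sets_independent_spacings [simp, measurable_cong]:
  "sets (independent_spacings l) = sets (\<Pi>\<^sub>M j\<in>UNIV. borel)"
  unfolding independent_spacings_def by (intro sets_PiM_cong) auto

lemma prob_space_independent_spacings: "l > 0 \<Longrightarrow> prob_space (independent_spacings l)"
  unfolding independent_spacings_def by (intro prob_space_PiM prob_space_exp_law) simp

lemma distr_independent_spacings_component:
  assumes "l > 0"
  shows "distr (independent_spacings l) borel (\<lambda>\<omega>. \<omega> j) = exp_law (real (Suc j) * l)"
proof -
  have "distr (independent_spacings l) borel (\<lambda>\<omega>. \<omega> j) = distr (independent_spacings l) (exp_law (real (Suc j) * l)) (\<lambda>\<omega>. \<omega> j)"
    by (intro distr_cong) auto
  also have "\<dots> = exp_law (real (Suc j) * l)"
    unfolding independent_spacings_def using assms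
    by (intro distr_PiM_component prob_space_exp_law) auto
  finally show ?thesis .
qed

lemma indep_vars_independent_spacings:
  assumes "l > 0"
  shows "prob_space.indep_vars (independent_spacings l) (\<lambda>_. borel) (\<lambda>j \<omega>. \<omega> j) UNIV"
proof -
  interpret prob_space "independent_spacings l" using assms by (rule prob_space_independent_spacings)
  have "distr (independent_spacings l) (\<Pi>\<^sub>M j\<in>UNIV. borel) (\<lambda>x. \<lambda>i\<in>UNIV. x i) = independent_spacings l"
    by (simp add: restrict_def distr_id2)
  also have "\<dots> = (\<Pi>\<^sub>M j\<in>UNIV. distr (independent_spacings l) borel (\<lambda>\<omega>. \<omega> j))"
    unfolding distr_independent_spacings_component[OF assms] by (simp add: independent_spacings_def)
  finally show ?thesis
    by (subst indep_vars_iff_distr_eq_PiM) auto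
qed

lemma partial_sum_law_0: "l > 0 \<Longrightarrow> partial_sum_law f l 0 = return borel 0"
  unfolding partial_sum_law_def by (simp add: prob_space.distr_const[OF prob_space_independent_spacings])

lemma prob_space_partial_sum_law:
  assumes "l > 0" and [measurable]: "f \<in> borel_measurable borel"
  shows "prob_space (partial_sum_law f l k)"
  unfolding partial_sum_law_def
  by (intro prob_space.prob_space_distr prob_space_independent_spacings assms) measurable

lemma sets_partial_sum_law [simp, measurable_cong]: "sets (partial_sum_law f l k) = sets borel"
  by (simp add: partial_sum_law_def)

lemma space_partial_sum_law [simp]: "space (partial_sum_law f l k) = UNIV"
  by (simp add: partial_sum_law_def)

lemma partial_sum_law_Suc:
  assumes "l > 0" and [measurable]: "f \<in> borel_measurable borel"
  shows "partial_sum_law f l (Suc k)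
    = distr (exp_law (real (Suc k) * l) \<Otimes>\<^sub>M partial_sum_law f l k) borel (\<lambda>(z, w). f z + w)"
proof -
  interpret prob_space "independent_spacings l" using assms by (intro prob_space_independent_spacings)
  have "indep_var borel ((\<lambda>g. g k) \<circ> (\<lambda>\<omega>. restrict (\<lambda>i. \<omega> i) {k}))
      borel ((\<lambda>g. \<Sum>j<k. f (g j)) \<circ> (\<lambda>\<omega>. restrict (\<lambda>i. \<omega> i) {..<k}))"
  proof (rule indep_var_compose[OF indep_var_restrict[OF indep_vars_independent_spacings[OF assms(1)]]])
    show "(\<lambda>g. \<Sum>j<k. f (g j)) \<in> borel_measurable (\<Pi>\<^sub>M j\<in>{..<k}. borel)"
      by measurable
  qed auto
  then have "indep_var borel (\<lambda>\<omega>. \<omega> k) borel (\<lambda>\<omega>. \<Sum>j<k. f (\<omega> j))"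
    by (simp add: comp_def)
  then have joint: "exp_law (real (Suc k) * l) \<Otimes>\<^sub>M partial_sum_law f l k
     = distr (independent_spacings l) (borel \<Otimes>\<^sub>M borel) (\<lambda>\<omega>. (\<omega> k, \<Sum>j<k. f (\<omega> j)))"
    unfolding indep_var_distribution_eq distr_independent_spacings_component[OF assms(1)] partial_sum_law_def by simp
  have "distr (distr (independent_spacings l) (borel \<Otimes>\<^sub>M borel) (\<lambda>\<omega>. (\<omega> k, \<Sum>j<k. f (\<omega> j)))) borel (\<lambda>(z, w). f z + w)
     = distr (independent_spacings l) borel ((\<lambda>(z, w). f z + w) \<circ> (\<lambda>\<omega>. (\<omega> k, \<Sum>j<k. f (\<omega> j))))"
    by (rule distr_distr) measurable
  also have "\<dots> = partial_sum_law f l (Suc k)"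
    by (simp add: partial_sum_law_def comp_def add.commute)
  finally show ?thesis unfolding joint ..
qed

section \<open>The spacings of an exponential sample\<close>

text \<open>
Renyi's representation of exponential spacings, in the form that survives induction: the minimum
has to be carried along, because the next spacing to the left is measured from it.

For the induction step, split according to the index \<open>i\<close> of the smallest observation.  The
remaining sample is independent of \<open>x i\<close> and its minimum and spacing sum are independent by the
induction hypothesis.  So \<open>x i\<close> competes with a single exponential clock, the minimum of the
others, and the race lemma yields the claimed law up to the probability \<open>1 / (k + 2)\<close> that \<open>i\<close>
wins; the sum over \<open>i\<close> cancels this factor.

With non-strict comparisons the events "\<open>i\<close> attains the minimum" cover everything but may
overlap when there are ties.  That gives an inequality between two probability measures, which
therefore coincide.
\<close>
lemma joint_law_of_min_and_spacing_sum:
  fixes J :: "'i set"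
  assumes l: "l > 0" and [measurable]: "f \<in> borel_measurable borel"
    and "finite J" "card J = Suc k"
  shows "distr (\<Pi>\<^sub>M j\<in>J. exp_law l) (borel \<Otimes>\<^sub>M borel)
            (\<lambda>x. (hd (sorted_values J x), spacing_sum f (sorted_values J x)))
       = exp_law (real (Suc k) * l) \<Otimes>\<^sub>M partial_sum_law f l k"
  using assms(3,4)
proof (induction k arbitrary: J)
  case 0
  then obtain i where J: "J = {i}" by (auto simp: card_1_singleton_iff)
  have sv: "sorted_values J x = [x i]" for x :: "'i \<Rightarrow> real"
    by (simp add: J sorted_values_def)
  interpret E: prob_space "exp_law l" using l by (rule prob_space_exp_law)
  interpret R: prob_space "return borel (0::real)" by (rule prob_space_return) simp
  interpret ER: pair_prob_space "exp_law l" "return borel (0::real)" ..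
  have "distr (\<Pi>\<^sub>M j\<in>J. exp_law l) (borel \<Otimes>\<^sub>M borel) (\<lambda>x. (x i, 0::real))
     = distr (distr (\<Pi>\<^sub>M j\<in>J. exp_law l) (exp_law l) (\<lambda>x. x i)) (borel \<Otimes>\<^sub>M borel) (\<lambda>m. (m, 0))"
    by (subst distr_distr) (auto simp: J comp_def)
  also have "distr (\<Pi>\<^sub>M j\<in>J. exp_law l) (exp_law l) (\<lambda>x. x i) = exp_law l"
    using l by (intro distr_PiM_component prob_space_exp_law) (auto simp: J)
  also have "distr (exp_law l) (borel \<Otimes>\<^sub>M borel) (\<lambda>m. (m, 0::real)) = exp_law l \<Otimes>\<^sub>M return borel 0"
  proof (rule measure_eqI)
    fix A assume "A \<in> sets (distr (exp_law l) (borel \<Otimes>\<^sub>M borel) (\<lambda>m. (m, 0::real)))"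
    then have A[measurable]: "A \<in> sets (borel \<Otimes>\<^sub>M borel)" by simp
    have "emeasure (exp_law l \<Otimes>\<^sub>M return borel 0) A
        = (\<integral>\<^sup>+m. \<integral>\<^sup>+w. indicator A (m, w) \<partial>return borel (0::real) \<partial>exp_law l)"
      by (subst R.emeasure_pair_measure) auto
    also have "\<dots> = (\<integral>\<^sup>+m. indicator A (m, 0) \<partial>exp_law l)"
      by (intro nn_integral_cong) (simp add: nn_integral_return)
    also have "\<dots> = emeasure (distr (exp_law l) (borel \<Otimes>\<^sub>M borel) (\<lambda>m. (m, 0::real))) A"
      by (subst nn_integral_indicator[symmetric], simp, subst nn_integral_distr) auto
    finally show "emeasure (distr (exp_law l) (borel \<Otimes>\<^sub>M borel) (\<lambda>m. (m, 0::real))) A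
        = emeasure (exp_law l \<Otimes>\<^sub>M return borel 0) A" by simp
  qed (simp cong: sets_pair_measure_cong)
  finally show ?case by (simp add: sv partial_sum_law_0[OF l])
next
  case (Suc k)
  note J = \<open>finite J\<close> \<open>card J = Suc (Suc k)\<close>
  have rest: "finite (J - {i})" "card (J - {i}) = Suc k" "J - {i} \<noteq> {}" if "i \<in> J" for i
  proof -
    show "finite (J - {i})" "card (J - {i}) = Suc k" using J that by simp_all
    then show "J - {i} \<noteq> {}" by (metis card.empty nat.simps(3))
  qed
  let ?S = "borel \<Otimes>\<^sub>M borel :: (real \<times> real) measure"
  let ?\<mu> = "partial_sum_law f l"
  define b where "b = real (Suc k) * l"
  have b: "b > 0" using l by (simp add: b_def)
  have lb: "l + b = real (Suc (Suc k)) * l" by (simp add: b_def algebra_simps)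
  interpret E: prob_space "exp_law l" using l by (rule prob_space_exp_law)
  interpret B: prob_space "exp_law b" using b by (rule prob_space_exp_law)
  interpret LB: prob_space "exp_law (l + b)" using l b by (intro prob_space_exp_law) simp
  interpret mu: prob_space "?\<mu> j" for j
    using l by (rule prob_space_partial_sum_law) simp
  interpret Bmu: pair_prob_space "exp_law b" "?\<mu> k" ..
  interpret LBmu: pair_prob_space "exp_law (l + b)" "?\<mu> (Suc k)" ..
  interpret PiE: product_sigma_finite "\<lambda>_::'i. exp_law l"
    by (simp add: product_sigma_finite_def E.sigma_finite_measure_axioms)
  interpret PJ: prob_space "\<Pi>\<^sub>M j\<in>J. exp_law l"
    using l by (intro prob_space_PiM prob_space_exp_law)
  have meas: "(\<lambda>x. (hd (sorted_values I x), spacing_sum f (sorted_values I x)))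
      \<in> measurable (\<Pi>\<^sub>M j\<in>I'. exp_law l) ?S" if "finite I" "I \<noteq> {}" "I \<subseteq> I'" for I I' :: "'i set"
  proof -
    have comp: "(\<lambda>x. x j) \<in> borel_measurable (\<Pi>\<^sub>M j\<in>I'. exp_law l)" if "j \<in> I" for j
    proof -
      have [simp]: "j \<in> I'" using \<open>I \<subseteq> I'\<close> that by auto
      show ?thesis by measurable
    qed
    show ?thesis
      using measurable_min_and_spacing_sum[where X="\<lambda>j x. x j", OF \<open>finite I\<close> assms(2) comp] \<open>I \<noteq> {}\<close>
      by (intro measurable_Pair) auto
  qed
  show ?case
    unfolding lb[symmetric]
  proof (rule prob_measures_eqI_le)
    show "prob_space (distr (\<Pi>\<^sub>M j\<in>J. exp_law l) ?S
            (\<lambda>x. (hd (sorted_values J x), spacing_sum f (sorted_values J x))))"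
      using J by (intro PJ.prob_space_distr meas) auto
    show "prob_space (exp_law (l + b) \<Otimes>\<^sub>M ?\<mu> (Suc k))" by (rule LBmu.prob_space_axioms)
    show "sets (distr (\<Pi>\<^sub>M j\<in>J. exp_law l) ?S
            (\<lambda>x. (hd (sorted_values J x), spacing_sum f (sorted_values J x))))
        = sets (exp_law (l + b) \<Otimes>\<^sub>M ?\<mu> (Suc k))"
      by (simp cong: sets_pair_measure_cong)
  next
    fix A
    assume "A \<in> sets (distr (\<Pi>\<^sub>M j\<in>J. exp_law l) ?S
            (\<lambda>x. (hd (sorted_values J x), spacing_sum f (sorted_values J x))))"
    then have A[measurable]: "A \<in> sets ?S" by simp
    \<comment> \<open>\<open>G m p\<close> is the contribution of an index with value \<open>m\<close> when the others have minimum and spacing sum \<open>p\<close>.\<close>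
    define G where "G m p = (if m \<le> fst p then indicator A (m, f (fst p - m) + snd p) else 0 :: ennreal)"
      for m and p :: "real \<times> real"
    have G[measurable]: "(\<lambda>(m, p). G m p) \<in> borel_measurable (borel \<Otimes>\<^sub>M ?S)"
      unfolding G_def case_prod_beta by measurable
    define T where "T I x = (hd (sorted_values I x), spacing_sum f (sorted_values I x))"
      for I and x :: "'i \<Rightarrow> real"
    \<comment> \<open>An index attaining the minimum contributes exactly the left-hand side; the other summands are nonnegative.\<close>
    have pointwise: "indicator A (T J x) \<le> (\<Sum>i\<in>J. G (x i) (T (J - {i}) x))" for x
    proof -
      have "Min (x ` J) \<in> x ` J" using J by (intro Min_in) auto
      then obtain i where i: "i \<in> J" "x i = Min (x ` J)" by auto
      then have le: "x i \<le> x j" if "j \<in> J" for j using J that by simp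
      have ne: "finite (J - {i})" "J - {i} \<noteq> {}"
        using rest[OF i(1)] by simp_all
      have "x i \<le> hd (sorted_values (J - {i}) x)"
        using hd_sorted_values_ge_iff[OF ne] le by auto
      moreover have "sorted_values J x = x i # sorted_values (J - {i}) x"
        using J i le by (intro sorted_values_least) auto
      ultimately have "indicator A (T J x) = G (x i) (T (J - {i}) x)"
        using ne by (simp add: T_def G_def spacing_sum_Cons)
      also have "\<dots> \<le> (\<Sum>i\<in>J. G (x i) (T (J - {i}) x))"
        using J i by (intro member_le_sum) auto
      finally show ?thesis .
    qed
    define Q where "Q = emeasure (exp_law (l + b) \<Otimes>\<^sub>M ?\<mu> (Suc k)) A"
    have summand: "(\<integral>\<^sup>+x. G (x i) (T (J - {i}) x) \<partial>(\<Pi>\<^sub>M j\<in>J. exp_law l)) = ennreal (l / (l + b)) * Q"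
      if i: "i \<in> J" for i
    proof -
      note I = rest[OF i]
      have [measurable]: "T (J - {i}) \<in> measurable (\<Pi>\<^sub>M j\<in>J - {i}. exp_law l) ?S"
        "T (J - {i}) \<in> measurable (\<Pi>\<^sub>M j\<in>J. exp_law l) ?S"
        unfolding T_def using I by (auto intro!: meas)
      have [measurable]: "(\<lambda>x. G (x i) (T (J - {i}) x)) \<in> borel_measurable (\<Pi>\<^sub>M j\<in>J. exp_law l)"
        using i by measurable
      have "(\<integral>\<^sup>+x. G (x i) (T (J - {i}) x) \<partial>(\<Pi>\<^sub>M j\<in>J. exp_law l))
        = (\<integral>\<^sup>+m. \<integral>\<^sup>+x. G ((x(i := m)) i) (T (J - {i}) (x(i := m))) \<partial>(\<Pi>\<^sub>M j\<in>J - {i}. exp_law l) \<partial>exp_law l)"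
        using PiE.product_nn_integral_insert_rev[of "J - {i}" i "\<lambda>x. G (x i) (T (J - {i}) x)"] I i
        by (simp add: insert_absorb)
      also have "\<dots> = (\<integral>\<^sup>+m. \<integral>\<^sup>+x. G m (T (J - {i}) x) \<partial>(\<Pi>\<^sub>M j\<in>J - {i}. exp_law l) \<partial>exp_law l)"
      proof -
        have "T (J - {i}) (x(i := m)) = T (J - {i}) x" for x m
          unfolding T_def by (subst (1 2) sorted_values_cong[of _ "x(i := m)" x]) auto
        then show ?thesis by simp
      qed
      also have "\<dots> = (\<integral>\<^sup>+m. \<integral>\<^sup>+p. G m p \<partial>distr (\<Pi>\<^sub>M j\<in>J - {i}. exp_law l) ?S (T (J - {i})) \<partial>exp_law l)"
        by (subst nn_integral_distr) auto
      also have "\<dots> = (\<integral>\<^sup>+m. \<integral>\<^sup>+p. G m p \<partial>(exp_law b \<Otimes>\<^sub>M ?\<mu> k) \<partial>exp_law l)"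
        unfolding T_def Suc.IH[OF I(1,2)] b_def ..
      also have "\<dots> = (\<integral>\<^sup>+m. \<integral>\<^sup>+y. \<integral>\<^sup>+w. G m (y, w) \<partial>?\<mu> k \<partial>exp_law b \<partial>exp_law l)"
        by (subst mu.nn_integral_fst) auto
      also have "\<dots> = (\<integral>\<^sup>+m. \<integral>\<^sup>+y. (if m \<le> y then (\<integral>\<^sup>+w. indicator A (m, f (y - m) + w) \<partial>?\<mu> k) else 0) \<partial>exp_law b \<partial>exp_law l)"
        by (intro nn_integral_cong) (simp add: G_def)
      also have "\<dots> = ennreal (l / (l + b)) *
          (\<integral>\<^sup>+m. \<integral>\<^sup>+z. \<integral>\<^sup>+w. indicator A (m, f z + w) \<partial>?\<mu> k \<partial>exp_law b \<partial>exp_law (l + b))"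
        using l b by (intro exponential_race) measurable
      also have "(\<integral>\<^sup>+m. \<integral>\<^sup>+z. \<integral>\<^sup>+w. indicator A (m, f z + w) \<partial>?\<mu> k \<partial>exp_law b \<partial>exp_law (l + b))
         = (\<integral>\<^sup>+m. \<integral>\<^sup>+p. (case p of (z, w) \<Rightarrow> indicator A (m, f z + w)) \<partial>(exp_law b \<Otimes>\<^sub>M ?\<mu> k) \<partial>exp_law (l + b))"
        by (subst mu.nn_integral_fst[symmetric]) auto
      also have "\<dots> = (\<integral>\<^sup>+m. \<integral>\<^sup>+v. indicator A (m, v) \<partial>?\<mu> (Suc k) \<partial>exp_law (l + b))"
        unfolding partial_sum_law_Suc[OF l assms(2), of k] b_def[symmetric]
        by (subst nn_integral_distr) (auto simp: case_prod_beta')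
      also have "\<dots> = Q"
        unfolding Q_def by (subst mu.emeasure_pair_measure) auto
      finally show ?thesis .
    qed
    have TJ[measurable]: "T J \<in> measurable (\<Pi>\<^sub>M j\<in>J. exp_law l) ?S"
      unfolding T_def using J by (auto intro!: meas)
    have Tm: "T (J - {i}) \<in> measurable (\<Pi>\<^sub>M j\<in>J. exp_law l) ?S" if "i \<in> J" for i
      unfolding T_def using J rest[OF that] by (intro meas) auto
    have "emeasure (distr (\<Pi>\<^sub>M j\<in>J. exp_law l) ?S (T J)) A
       = (\<integral>\<^sup>+x. indicator A (T J x) \<partial>(\<Pi>\<^sub>M j\<in>J. exp_law l))"
      by (subst nn_integral_indicator[symmetric], simp, subst nn_integral_distr) auto
    also have "\<dots> \<le> (\<integral>\<^sup>+x. (\<Sum>i\<in>J. G (x i) (T (J - {i}) x)) \<partial>(\<Pi>\<^sub>M j\<in>J. exp_law l))"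
      by (intro nn_integral_mono pointwise)
    also have "\<dots> = (\<Sum>i\<in>J. \<integral>\<^sup>+x. G (x i) (T (J - {i}) x) \<partial>(\<Pi>\<^sub>M j\<in>J. exp_law l))"
    proof (rule nn_integral_sum)
      fix i assume i: "i \<in> J"
      have [measurable]: "T (J - {i}) \<in> measurable (\<Pi>\<^sub>M j\<in>J. exp_law l) ?S" by (rule Tm[OF i])
      show "(\<lambda>x. G (x i) (T (J - {i}) x)) \<in> borel_measurable (\<Pi>\<^sub>M j\<in>J. exp_law l)"
        using i by measurable
    qed
    also have "\<dots> = of_nat (card J) * (ennreal (l / (l + b)) * Q)"
      by (simp add: summand)
    also have "\<dots> = Q"
    proof -
      have "real (card J) * (l / (l + b)) = 1"
        using l unfolding lb J by simp
      then have "of_nat (card J) * ennreal (l / (l + b)) = 1"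
        by (metis ennreal_1 ennreal_mult'' ennreal_of_nat_eq_real_of_nat divide_nonneg_pos add_pos_pos b l less_imp_le)
      then show ?thesis by (simp add: mult.assoc[symmetric])
    qed
    finally show "emeasure (distr (\<Pi>\<^sub>M j\<in>J. exp_law l) ?S
            (\<lambda>x. (hd (sorted_values J x), spacing_sum f (sorted_values J x)))) A
        \<le> emeasure (exp_law (l + b) \<Otimes>\<^sub>M ?\<mu> (Suc k)) A"
      unfolding T_def Q_def .
  qed
qed

lemma summable_inverse_squares_Suc: "summable (\<lambda>j. (1 / real (Suc j))\<^sup>2)"
proof -
  have "summable (\<lambda>n. inverse (real n ^ 2))"
    by (rule inverse_power_summable) simp
  then have "summable (\<lambda>n. inverse (real (Suc n) ^ 2))"
    by (subst summable_Suc_iff)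
  then show ?thesis by (simp add: power_one_over inverse_eq_divide del: of_nat_Suc)
qed

text \<open>
The natural number \<open>card J - 1\<close> is the right count for the empty sample as well, since both
sides are then the point mass at \<open>0\<close>.
\<close>
lemma law_of_spacing_sum:
  fixes M :: "'a measure" and X :: "'i \<Rightarrow> 'a \<Rightarrow> real"
  assumes "prob_space M" and l: "l > 0" and f: "f \<in> borel_measurable borel" and J: "finite J"
    and indep: "prob_space.indep_vars M (\<lambda>_. borel) X J"
    and exp: "\<And>j. j \<in> J \<Longrightarrow> distr M borel (X j) = exp_law l"
  shows "distr M borel (\<lambda>\<omega>. spacing_sum f (sorted_values J (\<lambda>j. X j \<omega>))) = partial_sum_law f l (card J - 1)"
proof (cases "J = {}")
  case True
  have empty: "sorted_values {} x = []" for x :: "'i \<Rightarrow> real"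
    by (simp add: sorted_values_def)
  show ?thesis using partial_sum_law_0[OF l] prob_space.distr_const[OF \<open>prob_space M\<close>, of 0 borel]
    unfolding True by (simp add: empty)
next
  case False
  note [measurable] = f
  interpret prob_space M by fact
  have X: "X j \<in> borel_measurable M" if "j \<in> J" for j
    using indep[unfolded indep_vars_def, THEN conjunct1] that by blast
  define k where "k = card J - 1"
  have "card J > 0" using J False by (simp add: card_gt_0_iff)
  then have k: "card J = Suc k" by (simp add: k_def)
  define S where "S x = sorted_values J x" for x :: "'i \<Rightarrow> real"
  let ?P = "\<Pi>\<^sub>M j\<in>J. exp_law l" and ?R = "exp_law (real (Suc k) * l)" and ?\<mu> = "partial_sum_law f l k"
  interpret R: prob_space ?R using l by (intro prob_space_exp_law) simp
  interpret mu: prob_space ?\<mu> using l f by (rule prob_space_partial_sum_law)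
  have "(\<lambda>x. x j) \<in> borel_measurable ?P" if "j \<in> J" for j
    using that by measurable
  note measurable_min_and_spacing_sum[where X="\<lambda>j x. x j", OF J f this]
  then have [measurable]: "(\<lambda>x. hd (S x)) \<in> borel_measurable ?P" "(\<lambda>x. spacing_sum f (S x)) \<in> borel_measurable ?P"
    using False unfolding S_def by auto
  have "sets ?P = sets (\<Pi>\<^sub>M j\<in>J. borel)"
    by (intro sets_PiM_cong) auto
  then have Pm: "(\<lambda>x. spacing_sum f (S x)) \<in> borel_measurable (\<Pi>\<^sub>M j\<in>J. borel)"
    by (simp cong: measurable_cong_sets)
  have "distr M borel (\<lambda>\<omega>. spacing_sum f (sorted_values J (\<lambda>j. X j \<omega>)))
      = distr M borel ((\<lambda>x. spacing_sum f (S x)) \<circ> (\<lambda>\<omega>. \<lambda>j\<in>J. X j \<omega>))"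
    unfolding comp_def S_def
    by (intro arg_cong[where f="distr M borel"] ext arg_cong[where f="spacing_sum f"] sorted_values_cong) simp
  also have "\<dots> = distr (distr M (\<Pi>\<^sub>M j\<in>J. borel) (\<lambda>\<omega>. \<lambda>j\<in>J. X j \<omega>)) borel (\<lambda>x. spacing_sum f (S x))"
    by (rule distr_distr[symmetric, OF Pm]) (intro measurable_restrict X)
  also have "distr M (\<Pi>\<^sub>M j\<in>J. borel) (\<lambda>\<omega>. \<lambda>j\<in>J. X j \<omega>) = ?P"
    using indep_vars_iff_distr_eq_PiM'[OF False, of X "\<lambda>_. borel"] X indep exp
    by (simp cong: PiM_cong)
  also have "distr ?P borel (\<lambda>x. spacing_sum f (S x))
      = distr ?P borel (snd \<circ> (\<lambda>x. (hd (S x), spacing_sum f (S x))))"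
    by (simp add: comp_def)
  also have "\<dots> = distr (distr ?P (borel \<Otimes>\<^sub>M borel) (\<lambda>x. (hd (S x), spacing_sum f (S x)))) borel snd"
    by (rule distr_distr[symmetric]) measurable
  also have "\<dots> = distr (?R \<Otimes>\<^sub>M ?\<mu>) borel snd"
    unfolding S_def joint_law_of_min_and_spacing_sum[OF l f J k] ..
  also have "\<dots> = ?\<mu>"
  proof (rule measure_eqI)
    fix A assume "A \<in> sets (distr (?R \<Otimes>\<^sub>M ?\<mu>) borel snd)"
    then have A: "A \<in> sets borel" by simp
    have "snd -` A \<inter> space (?R \<Otimes>\<^sub>M ?\<mu>) = space ?R \<times> A"
      by (auto simp: space_pair_measure)
    moreover have "snd \<in> borel_measurable (?R \<Otimes>\<^sub>M ?\<mu>)"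
      by measurable
    ultimately have "emeasure (distr (?R \<Otimes>\<^sub>M ?\<mu>) borel snd) A = emeasure (?R \<Otimes>\<^sub>M ?\<mu>) (space ?R \<times> A)"
      using A by (simp only: emeasure_distr)
    also have "\<dots> = emeasure ?\<mu> A"
      using A mu.emeasure_pair_measure_Times[OF sets.top[of ?R], of A]
      by (simp only: R.emeasure_space_1 sets_partial_sum_law mult_1_left)
    finally show "emeasure (distr (?R \<Otimes>\<^sub>M ?\<mu>) borel snd) A = emeasure ?\<mu> A" .
  qed simp
  finally show ?thesis unfolding k_def .
qed

section \<open>Convergence of the series of independent spacings\<close>

text \<open>
This is the Cauchy-Schwarz inequality for \<open>a j = (1 / (j + 1)) * ((j + 1) * a j)\<close>.  Finiteness
of one weighted sum of squares thus controls both the convergence of the series and its square.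
\<close>
lemma square_suminf_le_weighted:
  fixes a :: "nat \<Rightarrow> real"
  assumes nonneg: "\<And>j. 0 \<le> a j" and sq: "summable (\<lambda>j. (real (Suc j) * a j)\<^sup>2)"
  shows "summable a"
    and "(\<Sum>j. a j)\<^sup>2 \<le> (\<Sum>j. (1 / real (Suc j))\<^sup>2) * (\<Sum>j. (real (Suc j) * a j)\<^sup>2)"
proof -
  define c where "c = (\<Sum>j. (1 / real (Suc j))\<^sup>2)"
  define V where "V = (\<Sum>j. (real (Suc j) * a j)\<^sup>2)"
  note w = summable_inverse_squares_Suc
  have "(\<Sum>j<n. a j)\<^sup>2 \<le> c * V" for n
  proof -
    have "(\<Sum>j<n. a j)\<^sup>2 = (\<Sum>j<n. (1 / real (Suc j)) * (real (Suc j) * a j))\<^sup>2"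
      by (intro arg_cong[where f="\<lambda>x. x\<^sup>2"] sum.cong) simp_all
    also have "\<dots> \<le> (\<Sum>j<n. (1 / real (Suc j))\<^sup>2) * (\<Sum>j<n. (real (Suc j) * a j)\<^sup>2)"
      by (rule Cauchy_Schwarz_ineq_sum)
    also have "\<dots> \<le> c * V"
      unfolding c_def V_def
      by (intro mult_mono sum_le_suminf w sq suminf_nonneg sum_nonneg) auto
    finally show ?thesis .
  qed
  then have le: "(\<Sum>j<n. a j) \<le> sqrt (c * V)" for n
    by (rule real_le_rsqrt)
  show sum: "summable a"
    using nonneg le by (rule summableI_nonneg_bounded)
  have "(\<Sum>j. a j) \<le> sqrt (c * V)"
    using sum le by (rule suminf_le_const)
  moreover have "0 \<le> c * V"
    unfolding c_def V_def by (intro mult_nonneg_nonneg suminf_nonneg w sq) auto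
  ultimately show "(\<Sum>j. a j)\<^sup>2 \<le> (\<Sum>j. (1 / real (Suc j))\<^sup>2) * (\<Sum>j. (real (Suc j) * a j)\<^sup>2)"
    using suminf_nonneg[OF sum nonneg] unfolding c_def V_def
    by (metis power_mono real_sqrt_pow2)
qed

lemma nn_integral_exp_law_power:
  assumes "a > 0"
  shows "(\<integral>\<^sup>+y. ennreal (y ^ 4) \<partial>exp_law a) = ennreal (24 / a ^ 4)"
proof -
  have "(\<integral>\<^sup>+y. ennreal (y ^ 4) \<partial>exp_law a)
      = (\<integral>\<^sup>+y. ennreal (exponential_density a y * y ^ 4) \<partial>lborel)"
    using assms by (subst nn_integral_exp_law) (auto intro!: nn_integral_cong simp: ennreal_mult')
  then show ?thesis
    using nn_integral_erlang_ith_moment[OF assms, of 0 4] by (simp add: fact_numeral)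
qed

text \<open>
A spacing of rate \<open>(j + 1) l\<close> has a fourth moment of order \<open>1 / (j + 1) ^ 4\<close>, so the quadratic
bound on \<open>f\<close> makes the weighted second moments summable.
\<close>
lemma nn_integral_weighted_squares_finite:
  assumes l: "l > 0" and f: "f \<in> borel_measurable borel"
    and bound: "\<And>y. 0 \<le> f y" "\<And>y. f y \<le> C * y\<^sup>2"
  shows "(\<integral>\<^sup>+\<omega>. (\<Sum>j. ennreal ((real (Suc j) * f (\<omega> j))\<^sup>2)) \<partial>independent_spacings l) < \<infinity>"
proof -
  note [measurable] = f
  define D where "D = 24 * C\<^sup>2 / l ^ 4"
  have "(\<integral>\<^sup>+\<omega>. ennreal ((real (Suc j) * f (\<omega> j))\<^sup>2) \<partial>independent_spacings l) \<le> ennreal (D * (1 / real (Suc j))\<^sup>2)" for j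
  proof -
    have "(\<integral>\<^sup>+\<omega>. ennreal ((real (Suc j) * f (\<omega> j))\<^sup>2) \<partial>independent_spacings l)
        = (\<integral>\<^sup>+y. ennreal ((real (Suc j) * f y)\<^sup>2) \<partial>exp_law (real (Suc j) * l))"
      unfolding distr_independent_spacings_component[OF l, symmetric] by (subst nn_integral_distr) auto
    also have "\<dots> \<le> (\<integral>\<^sup>+y. ennreal ((real (Suc j) * C)\<^sup>2) * ennreal (y ^ 4) \<partial>exp_law (real (Suc j) * l))"
    proof (intro nn_integral_mono)
      fix y :: real
      have "(real (Suc j) * f y)\<^sup>2 \<le> (real (Suc j) * (C * y\<^sup>2))\<^sup>2"
        using bound[of y] by (intro power_mono mult_left_mono mult_nonneg_nonneg) auto
      also have "\<dots> = (real (Suc j) * C)\<^sup>2 * y ^ 4"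
        by (simp add: power_mult_distrib)
      finally show "ennreal ((real (Suc j) * f y)\<^sup>2) \<le> ennreal ((real (Suc j) * C)\<^sup>2) * ennreal (y ^ 4)"
        by (subst ennreal_mult'[symmetric]) (auto intro: ennreal_leI)
    qed
    also have "\<dots> = ennreal ((real (Suc j) * C)\<^sup>2) * ennreal (24 / (real (Suc j) * l) ^ 4)"
      using l by (subst nn_integral_cmult) (auto simp del: of_nat_Suc simp: nn_integral_exp_law_power)
    also have "\<dots> = ennreal ((real (Suc j) * C)\<^sup>2 * (24 / (real (Suc j) * l) ^ 4))"
      by (subst ennreal_mult') auto
    also have "(real (Suc j) * C)\<^sup>2 * (24 / (real (Suc j) * l) ^ 4) = D * (1 / real (Suc j))\<^sup>2"
      using l by (simp add: D_def power_mult_distrib divide_simps power2_eq_square power4_eq_xxxx del: of_nat_Suc)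
    finally show ?thesis .
  qed
  then have "(\<Sum>j. \<integral>\<^sup>+\<omega>. ennreal ((real (Suc j) * f (\<omega> j))\<^sup>2) \<partial>independent_spacings l)
      \<le> (\<Sum>j. ennreal (D * (1 / real (Suc j))\<^sup>2))"
    by (intro suminf_le summableI) auto
  also have "\<dots> < \<infinity>"
  proof -
    have "(\<Sum>j. ennreal (D * (1 / real (Suc j))\<^sup>2)) \<noteq> top"
      by (intro ennreal_suminf_neq_top summable_mult summable_inverse_squares_Suc) (auto simp: D_def)
    then show ?thesis by (simp add: less_top)
  qed
  finally show ?thesis
    by (subst nn_integral_suminf) auto
qed

text \<open>
The limit is the law of the infinite series, which converges almost surely.  Almost sure
convergence gives pointwise convergence of the characteristic functions by dominated convergence,
and Levy's continuity theorem gives weak convergence.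
\<close>
lemma partial_sum_law_converges:
  assumes l: "l > 0" and f: "f \<in> borel_measurable borel"
    and bound: "\<And>y. 0 \<le> f y" "\<And>y. f y \<le> C * y\<^sup>2"
  obtains N where "real_distribution N" "weak_conv_m (partial_sum_law f l) N" "integrable N (\<lambda>z. z\<^sup>2)"
proof
  note [measurable] = f
  interpret prob_space "independent_spacings l" using l by (rule prob_space_independent_spacings)
  define V where "V \<omega> = (\<Sum>j. ennreal ((real (Suc j) * f (\<omega> j))\<^sup>2))" for \<omega>
  define Z where "Z \<omega> = (\<Sum>j. f (\<omega> j))" for \<omega>
  define c where "c = (\<Sum>j. (1 / real (Suc j))\<^sup>2)"
  have [measurable]: "V \<in> borel_measurable (independent_spacings l)" "Z \<in> borel_measurable (independent_spacings l)"
    unfolding V_def Z_def by measurable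
  have V: "(\<integral>\<^sup>+\<omega>. V \<omega> \<partial>independent_spacings l) < \<infinity>"
    unfolding V_def by (intro nn_integral_weighted_squares_finite[OF l f bound])
  then have "AE \<omega> in independent_spacings l. V \<omega> \<noteq> \<infinity>"
    by (intro nn_integral_noteq_infinite) auto
  then have AE: "AE \<omega> in independent_spacings l. (\<lambda>n. \<Sum>j<n. f (\<omega> j)) \<longlonglongrightarrow> Z \<omega> \<and> ennreal ((Z \<omega>)\<^sup>2) \<le> ennreal c * V \<omega>"
  proof eventually_elim
    case (elim \<omega>)
    then have sq: "summable (\<lambda>j. (real (Suc j) * f (\<omega> j))\<^sup>2)"
      unfolding V_def by (intro summable_suminf_not_top) (auto simp del: of_nat_Suc)
    note * = square_suminf_le_weighted[OF bound(1) sq]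
    have "ennreal ((Z \<omega>)\<^sup>2) \<le> ennreal (c * (\<Sum>j. (real (Suc j) * f (\<omega> j))\<^sup>2))"
      using *(2) unfolding Z_def c_def by (rule ennreal_leI)
    also have "\<dots> = ennreal c * ennreal (\<Sum>j. (real (Suc j) * f (\<omega> j))\<^sup>2)"
      by (intro ennreal_mult'' suminf_nonneg sq) simp
    also have "ennreal (\<Sum>j. (real (Suc j) * f (\<omega> j))\<^sup>2) = V \<omega>"
      using elim unfolding V_def by (intro suminf_ennreal[symmetric]) (auto simp del: of_nat_Suc)
    finally show ?case
      using summable_LIMSEQ[OF *(1)] by (simp add: Z_def)
  qed
  let ?N = "distr (independent_spacings l) borel Z"
  show rd: "real_distribution ?N" by simp
  show "weak_conv_m (partial_sum_law f l) ?N"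
  proof (rule levy_continuity)
    show "real_distribution (partial_sum_law f l n)" for n
      unfolding partial_sum_law_def by (rule real_distribution_distr) measurable
    show "(\<lambda>n. char (partial_sum_law f l n) t) \<longlonglongrightarrow> char ?N t" for t
    proof -
      have "(\<lambda>n. \<integral>\<omega>. iexp (t * (\<Sum>j<n. f (\<omega> j))) \<partial>independent_spacings l) \<longlonglongrightarrow> (\<integral>\<omega>. iexp (t * Z \<omega>) \<partial>independent_spacings l)"
      proof (rule integral_dominated_convergence[where w="\<lambda>_. 1"])
        show "AE \<omega> in independent_spacings l. (\<lambda>n. iexp (t * (\<Sum>j<n. f (\<omega> j)))) \<longlonglongrightarrow> iexp (t * Z \<omega>)"
          using AE by eventually_elim (auto intro!: tendsto_intros simp del: of_real_sum)
      qed auto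
      then show ?thesis
        unfolding char_def partial_sum_law_def by (subst (1 2) integral_distr) auto
    qed
  qed (rule rd)
  have "(\<integral>\<^sup>+\<omega>. ennreal (norm ((Z \<omega>)\<^sup>2)) \<partial>independent_spacings l) \<le> (\<integral>\<^sup>+\<omega>. ennreal c * V \<omega> \<partial>independent_spacings l)"
    using AE by (intro nn_integral_mono_AE) auto
  also have "\<dots> < \<infinity>"
    using V by (subst nn_integral_cmult) (auto simp: ennreal_mult_less_top)
  finally have "integrable (independent_spacings l) (\<lambda>\<omega>. (Z \<omega>)\<^sup>2)"
    by (intro integrableI_bounded) auto
  then show "integrable ?N (\<lambda>z. z\<^sup>2)"
    by (subst integrable_distr_eq) auto
qed

lemma finite_mean_variance_of_square_integrable:
  assumes "prob_space N" "sets N = sets borel" and sq: "integrable N (\<lambda>z::real. z\<^sup>2)"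
  shows "finite_mean_variance N (\<lambda>z. z)"
proof -
  interpret prob_space N by fact
  have [measurable]: "(\<lambda>z. z) \<in> borel_measurable N"
    using assms(2) by (simp cong: measurable_cong_sets)
  have id: "integrable N (\<lambda>z. z)"
    by (rule square_integrable_imp_integrable[OF _ sq]) measurable
  then show ?thesis
    unfolding finite_mean_variance_def using sq by (simp add: power2_diff)
qed

section \<open>Convergence in distribution of hole statistics\<close>

lemma sum_gap_eq_spacing_sum:
  "(\<Sum>i = 1..n - 1. f (gap n x i)) = spacing_sum f (sorted_values {1..n} x)"
proof -
  have s: "sorted_values {1..n} x = sort (map x [1..<Suc n])"
    using sorted_values_eq_sort[of "[1..<Suc n]" x] by (simp add: atLeastLessThanSuc_atLeastAtMost del: upt_Suc)
  have "(\<Sum>i = 1..n - 1. f (gap n x i)) = (\<Sum>i<n - 1. f (gap n x (Suc i)))"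
    by (rule sum.reindex_bij_witness[of _ Suc "\<lambda>i. i - 1"]) auto
  then show ?thesis
    unfolding s spacing_sum_def by (simp add: gap_def order_stat_def del: upt_Suc)
qed

text \<open>
Both hole statistics are sums of one function \<open>f\<close> over all spacings.  The bound \<open>f y \<le> C y\<^sup>2\<close>
says that very small spacings, of which there are many, contribute little.
\<close>
lemma spacing_sum_converges_in_distribution:
  fixes M :: "nat \<Rightarrow> 'a measure" and X :: "nat \<Rightarrow> nat \<Rightarrow> 'a \<Rightarrow> real"
  assumes l: "l > 0"
    and M: "\<And>n. prob_space (M n)"
    and indep: "\<And>n. prob_space.indep_vars (M n) (\<lambda>_. borel) (X n) {1..n}"
    and exp: "\<And>n i. i \<in> {1..n} \<Longrightarrow> distributed (M n) lborel (X n i) (exponential_density l)"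
    and f: "f \<in> borel_measurable borel"
    and bound: "\<And>y. 0 \<le> f y" "\<And>y. f y \<le> C * y\<^sup>2"
  shows "\<exists>(N :: real measure) Z. prob_space N \<and> Z \<in> borel_measurable N \<and>
           converges_in_distribution M (\<lambda>n \<omega>. \<Sum>i = 1..n - 1. f (gap n (\<lambda>i. X n i \<omega>) i)) N Z \<and>
           finite_mean_variance N Z"
proof -
  obtain N where N: "real_distribution N" "weak_conv_m (partial_sum_law f l) N" "integrable N (\<lambda>z. z\<^sup>2)"
    using partial_sum_law_converges[OF l f bound] by blast
  interpret N: real_distribution N by fact
  have "distr (M n) borel (X n i) = exp_law l" if "i \<in> {1..n}" for n i
  proof -
    have "distr (M n) borel (X n i) = distr (M n) lborel (X n i)"
      by (rule distr_cong) auto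
    then show ?thesis
      using distributed_distr_eq_density[OF exp[OF that]] by (simp add: exp_law_def)
  qed
  then have law: "distr (M n) borel (\<lambda>\<omega>. \<Sum>i = 1..n - 1. f (gap n (\<lambda>i. X n i \<omega>) i)) = partial_sum_law f l (n - 1)" for n
    using law_of_spacing_sum[OF M l f _ indep, of n] unfolding sum_gap_eq_spacing_sum by simp
  have "(\<lambda>n. cdf (partial_sum_law f l (n - 1)) x) \<longlonglongrightarrow> cdf N x" if "isCont (cdf N) x" for x
    by (rule LIMSEQ_imp_Suc) (use N(2) that in \<open>simp add: weak_conv_m_def weak_conv_def\<close>)
  then have "weak_conv_m (\<lambda>n. partial_sum_law f l (n - 1)) N"
    by (simp add: weak_conv_m_def weak_conv_def)
  then have "converges_in_distribution M (\<lambda>n \<omega>. \<Sum>i = 1..n - 1. f (gap n (\<lambda>i. X n i \<omega>) i)) N (\<lambda>z. z)"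
    unfolding converges_in_distribution_def law by (simp add: distr_id2)
  then show ?thesis
    using finite_mean_variance_of_square_integrable[OF N.prob_space_axioms N.events_eq_borel N(3)] N.prob_space_axioms
    by (intro exI[of _ N] exI[of _ "\<lambda>z. z"]) (auto cong: measurable_cong_sets)
qed

theorem theorem5:
  fixes l r :: real
    and M :: "nat \<Rightarrow> 'a measure"
    and X :: "nat \<Rightarrow> nat \<Rightarrow> 'a \<Rightarrow> real"
  assumes "l > 0" and "r > 0"
    and "\<And>n. prob_space (M n)"
    and "\<And>n. prob_space.indep_vars (M n) (\<lambda>_. borel) (X n) {1..n}"
    and "\<And>n i. i \<in> {1..n} \<Longrightarrow> distributed (M n) lborel (X n i) (exponential_density l)"
  shows "(\<exists>(N :: real measure) Z. prob_space N \<and> Z \<in> borel_measurable N \<and>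
            converges_in_distribution M (\<lambda>n \<omega>. hole_length n r (\<lambda>i. X n i \<omega>)) N Z \<and>
            finite_mean_variance N Z)
       \<and> (\<exists>(N :: real measure) Z. prob_space N \<and> Z \<in> borel_measurable N \<and>
            converges_in_distribution M (\<lambda>n \<omega>. num_holes n r (\<lambda>i. X n i \<omega>)) N Z \<and>
            finite_mean_variance N Z)"
proof
  \<comment> \<open>A hole needs \<open>y > r\<close>, so each factor \<open>y / r\<close> inserted into an upper bound only increases it.\<close>
  have length_bound: "max (y - r) 0 \<le> (1 / r) * y\<^sup>2" for y :: real
  proof (cases "y > r")
    case True
    then have "r * y \<le> y * y" using \<open>r > 0\<close> by (intro mult_right_mono) auto
    then have "y \<le> (1 / r) * y\<^sup>2" using \<open>r > 0\<close> by (simp add: field_simps power2_eq_square)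
    then show ?thesis using True \<open>r > 0\<close> by simp
  next
    case False
    then show ?thesis using \<open>r > 0\<close> by simp
  qed
  show "\<exists>(N :: real measure) Z. prob_space N \<and> Z \<in> borel_measurable N \<and>
            converges_in_distribution M (\<lambda>n \<omega>. hole_length n r (\<lambda>i. X n i \<omega>)) N Z \<and>
            finite_mean_variance N Z"
    unfolding hole_length_def
    by (rule spacing_sum_converges_in_distribution[where f="\<lambda>y. max (y - r) 0", OF assms(1,3,4,5) _ _ length_bound]) auto
  have count_bound: "of_bool (y > r) \<le> (1 / r\<^sup>2) * y\<^sup>2" for y :: real
    using power_mono[of r y 2] \<open>r > 0\<close> by (auto simp: of_bool_def field_simps)
  show "\<exists>(N :: real measure) Z. prob_space N \<and> Z \<in> borel_measurable N \<and>
            converges_in_distribution M (\<lambda>n \<omega>. num_holes n r (\<lambda>i. X n i \<omega>)) N Z \<and>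
            finite_mean_variance N Z"
    unfolding num_holes_def
    by (rule spacing_sum_converges_in_distribution[where f="\<lambda>y. of_bool (y > r)", OF assms(1,3,4,5) _ _ count_bound])
      (auto simp: of_bool_def)
qed

end
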